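(* Let $1<q<p<\infty$ and let $\phi$ be a positive increasing function on $[0,1)$ such that $$\int_0^1(1-r)^{p-2}\phi(r)^p\,dr<\infty \qquad\text{and}\qquad \int_0^1(1-r)^{q-2}\phi(r)^q\,dr=\infty .$$ Then there exists a function $f\in (B^p\cap H^\infty)\setminus B^q$ with the following two properties: (i) there exist constants $C>0$ and $r_0\in(0,1)$ such that $M_p(r,f')\ge C\,\phi(r)$ for all $r\in[r_0,1)$; (ii) for every $\theta\in[0,2\pi]$, $$\int_0^1(1-r)^{q-2}\,|f'(re^{i\theta})|^q\,dr=\infty .$$
   Context: $\mathbb D=\{z\in\mathbb C:|z|<1\}$, and $dA(z)=\frac1\pi\,dx\,dy$ is normalized area measure on $\mathbb D$. For $g$ analytic in $\mathbb D$, $0\le r<1$ and $0<p<\infty$, $M_p(r,g)=\left(\frac{1}{2\pi}\int_0^{2\pi}|g(re^{i\theta})|^p\,d\theta\right)^{1/p}$. $H^\infty$ is the space of bounded analytic functions on $\mathbb D$. For $1<p<\infty$, the analytic Besov space $B^p$ is the set of functions $f$ analytic in $\mathbb D$ with $\int_{\mathbb D}(1-|z|^2)^{p-2}|f'(z)|^p\,dA(z)<\infty$. *)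

theory Defs
  imports "HOL-Analysis.Analysis"
begin

definition Mp :: "real \<Rightarrow> real \<Rightarrow> (complex \<Rightarrow> complex) \<Rightarrow> real" where
  "Mp p r g = ((1 / (2 * pi)) * integral {0..2*pi} (\<lambda>t. norm (g (complex_of_real r * cis t)) powr p)) powr (1 / p)"

definition Hinf :: "(complex \<Rightarrow> complex) set" where
  "Hinf = {f. f holomorphic_on ball 0 1 \<and> bounded (f ` ball 0 1)}"

text \<open>Analytic Besov space B^p; dA = (1/pi) dx dy is normalized area measure.\<close>
definition Besov :: "real \<Rightarrow> (complex \<Rightarrow> complex) set" where
  "Besov p = {f. f holomorphic_on ball 0 1 \<and>
     (\<integral>\<^sup>+ z \<in> ball 0 1. ennreal ((1 / pi) * (1 - (norm z)\<^sup>2) powr (p - 2) * norm (deriv f z) powr p) \<partial>lborel) < \<infinity>}"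

end

theory Submission
  imports Defs "HOL-Complex_Analysis.Cauchy_Integral_Formula"
begin

text \<open>
  Take \<open>f' = \<Sum>\<^sub>n \<psi>\<^sub>n z\<^bsup>L^n\<^esup>\<close> with a large integer \<open>L\<close> and coefficients
  \<open>\<psi>\<^sub>n \<ge> \<phi>(1 - L\<^bsup>-n\<^esup>)\<close>. A crude choice of coefficients would allow long plateaus and sudden jumps, so
  \<open>\<phi>(1 - L\<^bsup>-n\<^esup>)\<close> is first replaced by a majorant with \<open>9 \<psi>\<^sub>n \<le> \<psi>\<^sub>n\<^sub>+\<^sub>1 \<le> L \<psi>\<^sub>n\<close>; since
  these growth rates lie on either side of the critical rate \<open>L\<^bsup>1-1/p\<^esup>\<close>, the sum
  \<open>\<Sum>\<^sub>n L\<^bsup>-n(p-1)\<^esup> \<psi>\<^sub>n\<^bsup>p\<^esup>\<close> stays finite. Then the \<open>n\<close>-th term alone dominates \<open>f'\<close> on whole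
  circles: \<open>|f'|\<close> is at most a constant times \<open>\<psi>\<^sub>n\<close> where \<open>1 - |z| \<ge> L\<^bsup>-n-1\<^esup>\<close>, and at least \<open>\<psi>\<^sub>n/4\<close>
  where \<open>L\<^bsup>-n\<^esup>/4 \<le> 1 - |z| \<le> L\<^bsup>-n\<^esup>/2\<close>. Summing over these shells gives membership in \<open>B\<^bsup>p\<^esup>\<close> and the
  divergence of both \<open>q\<close>-integrals. The bound on \<open>M\<^sub>p\<close> holds on every circle because means dominate
  Taylor coefficients.
\<close>

section \<open>Regularising a summable sequence\<close>

text \<open>Two geometric smoothings, one per inequality. Convolving with the past,
  \<open>u\<close>, makes the sequence fall by at most the factor \<open>b\<close>. Averaging
  \<open>u\<close> over the future, \<open>x\<close>, gives
  \<open>x n = u n + c * x (Suc n)\<close>, which limits upward jumps, and the first property passes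
  through this average term by term. Both kernels are summable, so summability survives.\<close>

lemma doubly_regularized_majorant:
  fixes y :: "nat \<Rightarrow> real"
  assumes y: "\<And>n. 0 \<le> y n" "summable y" and b: "0 < b" "b < 1" and c: "0 < c" "c < 1"
  obtains x where "\<And>n. y n \<le> x n" "summable x" "\<And>n. b * x n \<le> x (Suc n)" "\<And>n. c * x (Suc n) \<le> x n"
proof -
  define u where "u n = (\<Sum>i\<le>n. y i * b ^ (n - i))" for n
  have su: "summable u"
    unfolding u_def using y b by (intro summable_Cauchy_product) (auto intro: summable_geometric)
  have u0: "0 \<le> u n" for n
    unfolding u_def using y b by (intro sum_nonneg) auto
  have uS: "u (Suc n) = y (Suc n) + b * u n" for n
  proof -
    have "(\<Sum>i\<le>n. y i * b ^ (Suc n - i)) = b * u n"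
      unfolding u_def sum_distrib_left by (intro sum.cong) (auto simp: Suc_diff_le)
    then show ?thesis by (simp add: u_def)
  qed
  have yu: "y n \<le> u n" for n
    using u0 uS b by (cases n) (auto simp: u_def[of 0])
  obtain K where K: "\<And>n. u n \<le> K"
  proof
    show "u n \<le> suminf u" for n
      using sum_le_suminf[OF su, of "{n}"] u0 by simp
  qed
  define x where "x n = (\<Sum>j. u (n + j) * c ^ j)" for n
  have sx: "summable (\<lambda>j. u (n + j) * c ^ j)" for n
    by (rule summable_comparison_test'[of "\<lambda>j. K * c ^ j" 0])
       (use u0 K c in \<open>auto intro!: summable_mult summable_geometric mult_right_mono\<close>)
  have x_nonneg: "0 \<le> x n" for n
    unfolding x_def using u0 c by (intro suminf_nonneg sx) auto
  have xS: "x n = u n + c * x (Suc n)" for n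
  proof -
    have "x n = u n + (\<Sum>j. u (n + Suc j) * c ^ Suc j)"
      unfolding x_def using suminf_split_head[OF sx[of n]] by simp
    also have "(\<Sum>j. u (n + Suc j) * c ^ Suc j) = c * x (Suc n)"
      unfolding x_def using suminf_mult[OF sx[of "Suc n"], of c] by (simp add: mult_ac)
    finally show ?thesis .
  qed
  have "K \<ge> 0" using u0[of 0] K[of 0] by simp
  have xK: "x n \<le> K / (1 - c)" for n
  proof -
    have "x n \<le> (\<Sum>j. K * c ^ j)"
      unfolding x_def using K c by (intro suminf_le sx summable_mult summable_geometric mult_right_mono) auto
    also have "\<dots> = K / (1 - c)"
      using c by (simp add: suminf_mult suminf_geometric summable_geometric)
    finally show ?thesis .
  qed
  \<comment> \<open>Summing the recursion \<open>xS\<close> reproduces the partial sum on the right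
    with factor \<open>c < 1\<close>, so it can be absorbed; \<open>xK\<close> controls the boundary
    term \<open>x n\<close>.\<close>
  have "(\<Sum>i<n. x i) \<le> (suminf u + c * (K / (1 - c))) / (1 - c)" for n
  proof -
    have "(\<Sum>i<n. x i) = (\<Sum>i<n. u i) + c * (\<Sum>i<n. x (Suc i))"
      by (subst xS) (simp add: sum.distrib sum_distrib_left)
    also have "(\<Sum>i<n. x (Suc i)) = (\<Sum>i<n. x i) + x n - x 0"
      by (induction n) auto
    also have "(\<Sum>i<n. u i) \<le> suminf u"
      using su u0 by (intro sum_le_suminf) auto
    also have "suminf u + c * ((\<Sum>i<n. x i) + x n - x 0)
        \<le> suminf u + c * ((\<Sum>i<n. x i) + K / (1 - c))"
      using xK[of n] x_nonneg[of 0] c by (intro add_left_mono mult_left_mono) auto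
    finally have "(1 - c) * (\<Sum>i<n. x i) \<le> suminf u + c * (K / (1 - c))"
      by (simp add: algebra_simps)
    then show ?thesis
      using c by (subst pos_le_divide_eq) (auto simp: mult.commute)
  qed
  then have "summable x"
    by (intro bounded_imp_summable[where a = x, OF x_nonneg]) (simp only: flip: lessThan_Suc_atMost)
  moreover have "y n \<le> x n" for n
    using yu[of n] xS[of n] mult_nonneg_nonneg[OF less_imp_le[OF c(1)] x_nonneg[of "Suc n"]] by linarith
  moreover have "c * x (Suc n) \<le> x n" for n
    using xS[of n] u0[of n] by linarith
  moreover have "b * x n \<le> x (Suc n)" for n
  proof -
    have "b * x n = (\<Sum>j. b * (u (n + j) * c ^ j))"
      unfolding x_def using sx by (simp add: suminf_mult)
    also have "\<dots> \<le> x (Suc n)"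
      unfolding x_def
    proof (intro suminf_le sx summable_mult)
      fix j
      have "b * u (n + j) \<le> u (Suc n + j)"
        using uS[of "n + j"] y(1)[of "Suc (n + j)"] by simp
      then show "b * (u (n + j) * c ^ j) \<le> u (Suc n + j) * c ^ j"
        using c by (simp add: mult.assoc[symmetric] mult_right_mono)
    qed
    finally show ?thesis .
  qed
  ultimately show thesis using that by blast
qed

section \<open>Elementary inequalities and integrals\<close>

text \<open>With \<open>s = (1 - r) * m\<close> the power is at most \<open>exp (- s)\<close>, and
  \<open>exp s\<close> exceeds \<open>s^2 / 2\<close>. Quadratic decay suffices later: it beats
  coefficients growing by a factor of at most \<open>L\<close> per step, leaving a geometric tail of
  ratio \<open>1 / L\<close>.\<close>

lemma power_le_inverse_square:
  fixes r :: real
  assumes "0 \<le> r" "r < 1" "m > 0"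
  shows "r ^ m \<le> 2 / ((1 - r) * real m)\<^sup>2"
proof -
  define s where "s = (1 - r) * real m"
  have s: "s > 0" unfolding s_def using assms by simp
  have "r \<le> exp (- (1 - r))" using exp_ge_add_one_self[of "- (1 - r)"] by simp
  then have "r ^ m \<le> exp (- (1 - r)) ^ m" using assms by (intro power_mono) auto
  also have "\<dots> = 1 / exp s"
    unfolding s_def exp_of_nat_mult[symmetric] by (simp add: exp_minus field_simps flip: exp_add)
  also have "\<dots> \<le> 1 / (s\<^sup>2 / 2)"
    using s exp_lower_Taylor_quadratic[of s] by (intro divide_left_mono) auto
  finally show ?thesis by (simp add: s_def)
qed

text \<open>Convexity of the power function. Integrated over a circle, the tangent line yields
  Jensen's inequality for the \<open>p\<close>-mean. The endpoint \<open>x = 0\<close> is handled by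
  direct computation because convexity is applied on the open half-line.\<close>

lemma powr_above_tangent:
  fixes x a p :: real
  assumes "0 \<le> x" "0 < a" "1 \<le> p"
  shows "a powr p + p * a powr (p - 1) * (x - a) \<le> x powr p"
proof (cases "x = 0")
  case True
  have "a powr p = a powr (p - 1) * a" using assms by (simp add: powr_diff)
  moreover have "p * a powr p \<ge> a powr p" using assms by simp
  ultimately show ?thesis using True assms by (simp add: mult.assoc)
next
  case False
  have "x powr p - a powr p \<ge> p * a powr (p - 1) * (x - a)"
  proof (rule convex_on_imp_above_tangent[where A = "{0<..}"])
    show "convex_on {0<..} (\<lambda>x. x powr p)" using assms by (intro powr_convex)
    show "((\<lambda>x. x powr p) has_field_derivative p * a powr (p - 1)) (at a within {0<..})"
      using assms by (auto intro!: derivative_eq_intros has_real_derivative_powr[THEN DERIV_subset])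
  qed (use assms False in \<open>auto simp: interior_open\<close>)
  then show ?thesis by simp
qed

lemma cis_int_has_integral:
  "((\<lambda>t. cis (of_int k * t)) has_integral (if k = 0 then 2 * pi else 0)) {0..2*pi}"
proof (cases "k = 0")
  case True
  then show ?thesis using has_integral_const_real[of "1::complex" 0 "2*pi"] by (simp add: scaleR_conv_of_real)
next
  case False
  have "((\<lambda>t. cis (of_int k * t)) has_integral
      cis (of_int k * (2*pi)) / (\<i> * of_int k) - cis (of_int k * 0) / (\<i> * of_int k)) {0..2*pi}"
  proof (rule fundamental_theorem_of_calculus)
    fix t :: real
    show "((\<lambda>t. cis (of_int k * t) / (\<i> * of_int k)) has_vector_derivative cis (of_int k * t))
        (at t within {0..2*pi})"
      using False by (auto intro!: derivative_eq_intros simp: has_vector_derivative_def fun_eq_iff scaleR_conv_of_real mult_ac)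
  qed simp
  moreover have "cis (of_int k * (2*pi)) = 1"
    by (metis cis_multiple_2pi Ints_of_int mult.commute mult.assoc)
  ultimately show ?thesis using False by simp
qed

section \<open>Gap series with regularly growing coefficients\<close>

text \<open>The constants 9 and 257 make the terms below and above the \<open>n\<close>-th one sum to at most an eighth of
  its coefficient each, on the circles with \<open>(1 - |z|) L^n\<close> in \<open>[1/4, 1/2]\<close>.\<close>

locale regular_gap_series =
  fixes L :: nat and \<psi> :: "nat \<Rightarrow> real"
  assumes L: "L \<ge> 257"
    and pos: "0 < \<psi> n"
    and growth: "9 * \<psi> n \<le> \<psi> (Suc n)"
    and growth': "\<psi> (Suc n) \<le> real L * \<psi> n"
    and summable_coeffs: "summable (\<lambda>n. \<psi> n / real L ^ n)"
begin

text \<open>The primitive of \<open>G\<close> that vanishes at 0, integrated term by term.\<close>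

definition F :: "complex \<Rightarrow> complex" where
  "F z = (\<Sum>k. of_real (\<psi> k / (real L ^ k + 1)) * z ^ (L ^ k + 1))"

definition G :: "complex \<Rightarrow> complex" where
  "G z = (\<Sum>k. of_real (\<psi> k) * z ^ (L ^ k))"

section \<open>Size of the gap series on circles\<close>

lemma sum_below: "(\<Sum>k<n. \<psi> k) \<le> \<psi> n / 8"
proof (induction n)
  case 0
  then show ?case using pos[of 0] by simp
next
  case (Suc n)
  \<comment> \<open>Here 9 = 8 + 1: the sum through index \<open>n\<close> is at most 9/8 of
    \<open>\<psi> n\<close>, hence at most an eighth of the next coefficient.\<close>
  then show ?case using growth[of n] by simp
qed

lemma growth_iterated: "\<psi> (n + j) \<le> real L ^ j * \<psi> n"
proof (induction j)
  case (Suc j)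
  have "\<psi> (n + Suc j) \<le> real L * \<psi> (n + j)" using growth' by simp
  also have "\<dots> \<le> real L * (real L ^ j * \<psi> n)" by (intro mult_left_mono Suc) simp
  finally show ?case by (simp add: mult_ac)
qed simp

text \<open>Going up \<open>j\<close> indices multiplies the coefficient by at most
  \<open>L ^ j\<close>, while the inverse-square bound on the power gains
  \<open>L ^ (2 * j)\<close>.\<close>

lemma tail_term_le:
  fixes r :: real
  assumes "0 \<le> r" "r < 1"
  shows "\<psi> (n + j) * r ^ (L ^ (n + j)) \<le> \<psi> n * (2 / ((1 - r) * real L ^ n)\<^sup>2) * (1 / real L) ^ j"
proof -
  have L0: "real L > 0" using L by simp
  have "\<psi> (n + j) * r ^ (L ^ (n + j)) \<le> (real L ^ j * \<psi> n) * (2 / ((1 - r) * real (L ^ (n + j)))\<^sup>2)"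
    using assms L less_imp_le[OF pos] by (intro mult_mono growth_iterated power_le_inverse_square) auto
  also have "\<dots> = \<psi> n * (2 / ((1 - r) * real L ^ n)\<^sup>2) * (1 / real L) ^ j"
  proof -
    have "(real L ^ j * c) * (2 / (d * real L ^ j)\<^sup>2) = c * (2 / d\<^sup>2) * (1 / real L) ^ j" for c d
      using L0 by (simp add: field_simps power2_eq_square)
    from this[of "\<psi> n" "(1 - r) * real L ^ n"] show ?thesis by (simp only: power_add of_nat_mult of_nat_power mult.assoc)
  qed
  finally show ?thesis .
qed

lemma inverse_L_less_1: "1 / real L < 1" using L by simp

lemma summable_abs_G:
  assumes "0 \<le> r" "r < 1"
  shows "summable (\<lambda>k. \<psi> k * r ^ (L ^ k))"
proof (rule summable_comparison_test')
  show "summable (\<lambda>j. \<psi> 0 * (2 / ((1 - r) * real L ^ 0)\<^sup>2) * (1 / real L) ^ j)"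
    using inverse_L_less_1 by (intro summable_mult summable_geometric) auto
  fix j
  have "norm (\<psi> j * r ^ (L ^ j)) = \<psi> (0 + j) * r ^ (L ^ (0 + j))"
    using pos[of j] assms by (simp add: abs_mult)
  also have "\<dots> \<le> \<psi> 0 * (2 / ((1 - r) * real L ^ 0)\<^sup>2) * (1 / real L) ^ j"
    by (rule tail_term_le[OF assms])
  finally show "norm (\<psi> j * r ^ (L ^ j)) \<le> \<psi> 0 * (2 / ((1 - r) * real L ^ 0)\<^sup>2) * (1 / real L) ^ j" .
qed

lemma summable_G:
  fixes z :: complex
  assumes "norm z < 1"
  shows "summable (\<lambda>k. of_real (\<psi> k) * z ^ (L ^ k))"
proof (rule summable_norm_cancel)
  have "norm (of_real (\<psi> k) * z ^ (L ^ k)) = \<psi> k * norm z ^ (L ^ k)" for k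
    using less_imp_le[OF pos] by (simp add: norm_mult norm_power)
  then show "summable (\<lambda>k. norm (of_real (\<psi> k) * z ^ (L ^ k)))"
    using summable_abs_G[OF norm_ge_zero assms] by simp
qed

text \<open>The series is split at index \<open>n\<close>. Below, powers of \<open>z\<close> are at
  most 1 and \<open>sum_below\<close> applies; above, \<open>tail_term_le\<close> gives a geometric
  series starting at \<open>j = 1\<close>, whose sum is \<open>1 / (L - 1)\<close>.\<close>

lemma G_dominant_term:
  assumes "norm z < 1"
  shows "norm (G z - of_real (\<psi> n) * z ^ (L ^ n)) \<le> \<psi> n * (1 / 8 + 2 / ((1 - norm z) * real L ^ n)\<^sup>2 / (real L - 1))"
proof -
  let ?g = "\<lambda>k. of_real (\<psi> k) * z ^ (L ^ k)"
  let ?c = "\<psi> n * (2 / ((1 - norm z) * real L ^ n)\<^sup>2)"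
  have ng: "norm (?g k) = \<psi> k * norm z ^ (L ^ k)" for k
    using less_imp_le[OF pos] by (simp add: norm_mult norm_power)
  have L1: "real L > 1" using L by simp
  have "G z = (\<Sum>j. ?g (j + Suc n)) + (\<Sum>k<Suc n. ?g k)"
    unfolding G_def by (rule suminf_split_initial_segment[OF summable_G[OF assms]])
  then have "G z - ?g n = (\<Sum>k<n. ?g k) + (\<Sum>j. ?g (j + Suc n))" by simp
  moreover have "norm (\<Sum>k<n. ?g k) \<le> \<psi> n / 8"
  proof -
    have "norm (\<Sum>k<n. ?g k) \<le> (\<Sum>k<n. \<psi> k)"
      using assms less_imp_le[OF pos]
      by (intro sum_norm_le) (auto simp: ng intro!: mult_left_le power_le_one)
    then show ?thesis using sum_below[of n] by simp
  qed
  moreover have "norm (\<Sum>j. ?g (j + Suc n)) \<le> ?c / (real L - 1)"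
  proof -
    have s: "summable (\<lambda>j. ?c * (1 / real L) * (1 / real L) ^ j)"
      using inverse_L_less_1 by (intro summable_mult summable_geometric) auto
    have "norm (?g (j + Suc n)) \<le> ?c * (1 / real L) * (1 / real L) ^ j" for j
      using tail_term_le[of "norm z" n "Suc j"] assms unfolding ng by (simp add: add.commute mult.assoc)
    then have "norm (\<Sum>j. ?g (j + Suc n)) \<le> (\<Sum>j. ?c * (1 / real L) * (1 / real L) ^ j)"
      by (rule norm_suminf_le[OF _ s])
    also have "\<dots> = ?c * (1 / real L) * (1 / (1 - 1 / real L))"
      using inverse_L_less_1 by (subst suminf_mult) (auto simp: suminf_geometric summable_geometric)
    also have "\<dots> = ?c / (real L - 1)"
    proof -
      have "c * (1 / real L) * (1 / (1 - 1 / real L)) = c / (real L - 1)" for c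
        using L1 by (simp add: field_simps)
      then show ?thesis .
    qed
    finally show ?thesis .
  qed
  ultimately have "norm (G z - ?g n) \<le> \<psi> n / 8 + ?c / (real L - 1)"
    by (metis (no_types, lifting) add_mono norm_triangle_le)
  also have "\<dots> = \<psi> n * (1 / 8 + 2 / ((1 - norm z) * real L ^ n)\<^sup>2 / (real L - 1))"
    by (simp add: algebra_simps)
  finally show ?thesis .
qed

text \<open>The hypothesis says \<open>(1 - norm z) * L ^ n \<ge> 1 / L\<close>, so the tail costs
  at most \<open>2 * L^2\<close> times the coefficient; the remaining \<open>1 + 1 / 8\<close> is
  absorbed by the generous factor 4.\<close>

lemma norm_G_le:
  assumes "norm z < 1" "1 / real L ^ Suc n \<le> 1 - norm z"
  shows "norm (G z) \<le> 4 * (real L)\<^sup>2 * \<psi> n"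
proof -
  have L1: "real L \<ge> 257" using L by simp
  define t where "t = (1 - norm z) * real L ^ n"
  have "1 / real L \<le> t" unfolding t_def using assms(2) L1 by (simp add: field_simps)
  then have "(1 / real L)\<^sup>2 \<le> t\<^sup>2" by (intro power_mono) auto
  then have "2 / t\<^sup>2 / (real L - 1) \<le> 2 / (1 / real L)\<^sup>2 / 1"
    using L1 by (intro frac_le) auto
  then have "norm (G z - of_real (\<psi> n) * z ^ (L ^ n)) \<le> \<psi> n * (1 / 8 + 2 * (real L)\<^sup>2)"
    using G_dominant_term[OF assms(1), of n] less_imp_le[OF pos[of n]] unfolding t_def[symmetric]
    by (elim order_trans) (intro mult_left_mono, auto simp: power_divide)
  moreover have "norm (of_real (\<psi> n) * z ^ (L ^ n)) \<le> \<psi> n"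
    using assms(1) less_imp_le[OF pos[of n]]
    by (auto simp: norm_mult norm_power intro!: mult_left_le power_le_one)
  ultimately have "norm (G z) \<le> \<psi> n * (1 + 1 / 8 + 2 * (real L)\<^sup>2)"
    using norm_triangle_sub[of "G z" "of_real (\<psi> n) * z ^ (L ^ n)"] by (simp add: algebra_simps)
  also have "\<dots> \<le> \<psi> n * (4 * (real L)\<^sup>2)"
  proof -
    have "1 \<le> (real L)\<^sup>2" using L1 by (intro one_le_power) auto
    then show ?thesis using pos[of n] by (intro mult_left_mono) auto
  qed
  finally show ?thesis by (simp add: mult_ac)
qed

text \<open>The main term is at least half the coefficient and the error at most a quarter: 1/8 from
  below, and from above \<open>2 / (1 / 4)^2 / 256 = 1 / 8\<close>, which is where
  \<open>L \<ge> 257\<close> enters.\<close>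

lemma norm_G_ge:
  assumes z: "norm z < 1" and t: "1 / 4 * (1 / real L ^ n) \<le> 1 - norm z" "1 - norm z \<le> 1 / 2 * (1 / real L ^ n)"
  shows "\<psi> n / 4 \<le> norm (G z)"
proof -
  have L1: "real L \<ge> 257" using L by simp
  define t where "t = (1 - norm z) * real L ^ n"
  have t': "1 / 4 \<le> t" "t \<le> 1 / 2" unfolding t_def using t L1 by (simp_all add: field_simps)
  then have "(1 / 4)\<^sup>2 \<le> t\<^sup>2" by (intro power_mono) auto
  then have "2 / t\<^sup>2 / (real L - 1) \<le> 2 / (1 / 4)\<^sup>2 / 256"
    using L1 by (intro frac_le) auto
  then have "norm (G z - of_real (\<psi> n) * z ^ (L ^ n)) \<le> \<psi> n * (1 / 4)"
    using G_dominant_term[OF z, of n] less_imp_le[OF pos[of n]] unfolding t_def[symmetric]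
    by (elim order_trans) (intro mult_left_mono, auto simp: power_divide)
  moreover have "\<psi> n * (1 / 2) \<le> norm (of_real (\<psi> n) * z ^ (L ^ n))"
  proof -
    \<comment> \<open>Bernoulli's inequality gives \<open>norm z ^ (L ^ n) \<ge> 1 - t\<close>, and
      \<open>t \<le> 1 / 2\<close> on this shell.\<close>
    have "1 + real (L ^ n) * (norm z - 1) \<le> (1 + (norm z - 1)) ^ (L ^ n)"
      by (rule Bernoulli_inequality) simp
    moreover have "1 + real (L ^ n) * (norm z - 1) = 1 - t" by (simp add: t_def algebra_simps)
    ultimately have "1 / 2 \<le> norm z ^ (L ^ n)" using t' by simp
    then have "\<psi> n * (1 / 2) \<le> \<psi> n * norm z ^ (L ^ n)"
      using less_imp_le[OF pos[of n]] by (rule mult_left_mono)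
    then show ?thesis using less_imp_le[OF pos[of n]] by (simp add: norm_mult norm_power)
  qed
  ultimately show ?thesis
    using norm_triangle_ineq2[of "of_real (\<psi> n) * z ^ (L ^ n)" "G z"]
    by (simp add: norm_minus_commute)
qed

section \<open>The bounded primitive\<close>

lemma norm_F_term_le:
  fixes z :: complex
  assumes "norm z < 1"
  shows "norm (of_real (\<psi> k / (real L ^ k + 1)) * z ^ (L ^ k + 1)) \<le> \<psi> k / real L ^ k"
proof -
  have "norm (of_real (\<psi> k / (real L ^ k + 1)) * z ^ (L ^ k + 1)) = \<psi> k / (real L ^ k + 1) * norm z ^ (L ^ k + 1)"
    using less_imp_le[OF pos[of k]] by (simp only: norm_mult norm_power norm_of_real) simp
  also have "\<dots> \<le> \<psi> k / (real L ^ k + 1) * 1"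
    using assms less_imp_le[OF pos[of k]] by (intro mult_left_mono power_le_one) auto
  also have "\<dots> \<le> \<psi> k / real L ^ k"
    using L less_imp_le[OF pos[of k]] by (auto intro!: divide_left_mono mult_pos_pos add_nonneg_pos)
  finally show ?thesis .
qed

text \<open>The summable majorant \<open>\<psi> k / L ^ k\<close> is uniform over the disc, which
  justifies differentiating term by term.\<close>

lemma F_has_field_derivative:
  assumes "norm z < 1"
  shows "(F has_field_derivative G z) (at z)"
proof -
  let ?f = "\<lambda>k z. of_real (\<psi> k / (real L ^ k + 1)) * z ^ (L ^ k + 1) :: complex"
  obtain g g' where g: "\<forall>z\<in>ball 0 1. (\<lambda>k. ?f k z) sums g z
      \<and> (\<lambda>k. of_real (\<psi> k) * z ^ (L ^ k)) sums g' z \<and> (g has_field_derivative g' z) (at z)"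
  proof (rule series_and_derivative_comparison[where S = "ball (0::complex) 1" and f = ?f
        and f' = "\<lambda>k z. of_real (\<psi> k) * z ^ (L ^ k)", OF open_ball summable_coeffs])
    fix k and z :: complex
    have "complex_of_real (real L ^ k + 1) = of_nat (L ^ k + 1)" by simp
    moreover have "complex_of_nat (L ^ k + 1) \<noteq> 0" by (simp only: of_nat_eq_0_iff)
    ultimately have "of_real (\<psi> k / (real L ^ k + 1)) * (of_nat (L ^ k + 1) * (1 * z ^ (L ^ k + 1 - Suc 0)))
        = of_real (\<psi> k) * z ^ (L ^ k)"
      by (simp only: of_real_divide) simp
    then show "(?f k has_field_derivative of_real (\<psi> k) * z ^ (L ^ k)) (at z)"
      using DERIV_cmult[OF DERIV_power[OF DERIV_ident, of "L ^ k + 1" z UNIV], of "of_real (\<psi> k / (real L ^ k + 1))"] by metis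
  qed (use norm_F_term_le in \<open>auto intro!: always_eventually\<close>)
  have "g' z = G z" using g assms by (auto simp: G_def sums_iff)
  moreover have "g w = F w" if "w \<in> ball 0 1" for w
    using g that by (auto simp: F_def sums_iff)
  moreover have "(g has_field_derivative g' z) (at z)" using g assms by simp
  ultimately show ?thesis
    using assms by (intro has_field_derivative_transform_within_open[of g "G z" z "ball 0 1" F]) auto
qed

lemma F_Hinf: "F \<in> Hinf"
proof -
  have "F holomorphic_on ball 0 1"
    unfolding holomorphic_on_open[OF open_ball] by (metis F_has_field_derivative mem_ball_0)
  moreover have "norm (F z) \<le> (\<Sum>k. \<psi> k / real L ^ k)" if "norm z < 1" for z
    unfolding F_def by (rule norm_suminf_le[OF norm_F_term_le[OF that] summable_coeffs])
  then have "bounded (F ` ball 0 1)"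
    unfolding bounded_iff by (auto intro!: exI[of _ "\<Sum>k. \<psi> k / real L ^ k"])
  ultimately show ?thesis by (simp add: Hinf_def)
qed

lemma deriv_F: "norm z < 1 \<Longrightarrow> deriv F z = G z"
  using F_has_field_derivative DERIV_imp_deriv by blast

section \<open>Taylor coefficients and integral means\<close>

lemma continuous_on_G: "continuous_on (ball 0 1) G"
proof -
  have "deriv F holomorphic_on ball 0 1"
    using F_Hinf by (auto simp: Hinf_def intro: holomorphic_deriv)
  then have "continuous_on (ball 0 1) (deriv F)" by (rule holomorphic_on_imp_continuous_on)
  then show ?thesis by (rule continuous_on_eq) (simp add: deriv_F)
qed

text \<open>On a fixed circle the series converges uniformly, so it may be integrated term by term
  against the character of frequency \<open>L ^ n\<close>. Orthogonality leaves only
  \<open>k = n\<close>, the exponents being distinct.\<close>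

lemma G_coefficient_integral:
  assumes r: "0 \<le> r" "r < 1"
  shows "((\<lambda>t. G (of_real r * cis t) * cis (- (real (L ^ n) * t))) has_integral
      of_real (2 * pi * (\<psi> n * r ^ (L ^ n)))) {0..2*pi}"
proof -
  let ?h = "\<lambda>k t. of_real (\<psi> k * r ^ (L ^ k)) * cis (of_int (int (L ^ k) - int (L ^ n)) * t)"
  have h: "of_real (\<psi> k) * (of_real r * cis t) ^ (L ^ k) * cis (- (real (L ^ n) * t)) = ?h k t" for k t
  proof -
    have "cis t ^ N * cis (- (real M * t)) = cis (of_int (int N - int M) * t)" for N M
      unfolding Complex.DeMoivre cis_mult by (simp add: left_diff_distrib)
    from this[of "L ^ k" "L ^ n"] show ?thesis by (simp only: power_mult_distrib mult.assoc of_real_mult of_real_power)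
  qed
  have sum_h: "G (of_real r * cis t) * cis (- (real (L ^ n) * t)) = (\<Sum>k. ?h k t)" for t
    unfolding G_def h[symmetric]
    by (rule suminf_mult2[OF summable_G]) (use r in \<open>simp add: norm_mult\<close>)
  have "uniform_limit {0..2*pi} (\<lambda>m t. \<Sum>k<m. ?h k t) (\<lambda>t. \<Sum>k. ?h k t) sequentially"
    by (rule Weierstrass_m_test[OF _ summable_abs_G[OF r]])
       (use r less_imp_le[OF pos] in \<open>simp add: norm_mult norm_power\<close>)
  then obtain I J where I: "\<And>m. ((\<lambda>t. \<Sum>k<m. ?h k t) has_integral I m) {0..2*pi}"
    and J: "((\<lambda>t. \<Sum>k. ?h k t) has_integral J) {0..2*pi}" and IJ: "I \<longlonglongrightarrow> J"
    by (rule uniform_limit_integral) (auto intro!: continuous_intros)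
  have "((\<lambda>t. \<Sum>k<m. ?h k t) has_integral
      (\<Sum>k<m. of_real (\<psi> k * r ^ (L ^ k)) * complex_of_real (if int (L ^ k) - int (L ^ n) = 0 then 2 * pi else 0))) {0..2*pi}" for m
    by (intro has_integral_sum has_integral_mult_right cis_int_has_integral) auto
  then have Im: "I m = (\<Sum>k<m. of_real (\<psi> k * r ^ (L ^ k)) * complex_of_real (if int (L ^ k) - int (L ^ n) = 0 then 2 * pi else 0))" for m
    using I has_integral_unique by blast
  have inj: "L ^ k = L ^ n \<longleftrightarrow> k = n" for k using L by (simp add: power_inject_exp)
  \<comment> \<open>The integrals of the partial sums are constant once index \<open>n\<close> is
    included, so their limit is immediate.\<close>
  have "I m = of_real (2 * pi * (\<psi> n * r ^ (L ^ n)))" if "m > n" for m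
  proof -
    have "I m = (\<Sum>k<m. if k = n then of_real (2 * pi * (\<psi> n * r ^ (L ^ n))) else 0)"
      unfolding Im by (intro sum.cong refl) (auto simp: inj simp flip: of_nat_power)
    then show ?thesis using that by simp
  qed
  then have "I \<longlonglongrightarrow> of_real (2 * pi * (\<psi> n * r ^ (L ^ n)))"
    by (intro tendsto_eventually eventually_mono[OF eventually_gt_at_top[of n]])
  then have "J = of_real (2 * pi * (\<psi> n * r ^ (L ^ n)))" using IJ LIMSEQ_unique by blast
  then show ?thesis using J unfolding sum_h by simp
qed

text \<open>The coefficient integral bounds the \<open>L^1\<close> mean from below by
  \<open>a\<close>; Jensen's inequality, through the tangent at \<open>a\<close>, lifts this to the
  \<open>p\<close>-mean.\<close>

lemma Mp_deriv_F_ge: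
  assumes r: "0 < r" "r < 1" and p: "1 \<le> p"
  shows "\<psi> n * r ^ (L ^ n) \<le> Mp p r (deriv F)"
proof -
  define a where "a = \<psi> n * r ^ (L ^ n)"
  have a: "a > 0" unfolding a_def using pos r by simp
  let ?g = "\<lambda>t. norm (G (of_real r * cis t))"
  have cG: "continuous_on {0..2*pi} (\<lambda>t. G (of_real r * cis t))"
    using r by (intro continuous_on_compose2[OF continuous_on_G]) (auto intro!: continuous_intros simp: norm_mult)
  have int_g: "?g integrable_on {0..2*pi}"
    by (intro integrable_continuous_real continuous_intros cG)
  have int_gp: "(\<lambda>t. ?g t powr p) integrable_on {0..2*pi}"
    using p by (intro integrable_continuous_real continuous_on_powr' continuous_intros cG) auto
  have "norm (complex_of_real (2 * pi * a)) \<le> integral {0..2*pi} ?g"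
    using has_integral_integrable[OF G_coefficient_integral[of r n]] r int_g
    unfolding a_def integral_unique[OF G_coefficient_integral[of r n], symmetric, OF less_imp_le[OF r(1)] r(2)]
    by (intro integral_norm_bound_integral) (auto simp: norm_mult)
  then have ga: "2 * pi * a \<le> integral {0..2*pi} ?g" using a by (simp only: norm_of_real abs_of_pos mult_pos_pos pi_gt_zero zero_less_numeral)
  let ?k = "p * a powr (p - 1)"
  have tangent: "((\<lambda>t. (a powr p - ?k * a) + ?k * ?g t) has_integral
      (2 * pi) * (a powr p - ?k * a) + ?k * integral {0..2*pi} ?g) {0..2*pi}"
    using has_integral_const_real[of "a powr p - ?k * a" 0 "2*pi"]
    by (intro has_integral_add has_integral_mult_right integrable_integral int_g) auto
  \<comment> \<open>The linear part of the integrated tangent is nonnegative, because by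
    \<open>ga\<close> the mean of \<open>?g\<close> is at least \<open>a\<close>.\<close>
  have "2 * pi * a powr p \<le> (2 * pi) * (a powr p - ?k * a) + ?k * integral {0..2*pi} ?g"
    using mult_left_mono[OF ga, of ?k] a p by (simp add: algebra_simps)
  also have "\<dots> \<le> integral {0..2*pi} (\<lambda>t. ?g t powr p)"
  proof (rule has_integral_le[OF tangent integrable_integral[OF int_gp]])
    fix t
    show "(a powr p - ?k * a) + ?k * ?g t \<le> ?g t powr p"
      using powr_above_tangent[OF norm_ge_zero a p, of "G (of_real r * cis t)"] by (simp add: algebra_simps)
  qed
  finally have "a powr p \<le> 1 / (2 * pi) * integral {0..2*pi} (\<lambda>t. ?g t powr p)"
    by (simp add: field_simps)
  then have "(a powr p) powr (1 / p) \<le> (1 / (2 * pi) * integral {0..2*pi} (\<lambda>t. ?g t powr p)) powr (1 / p)"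
    using p by (intro powr_mono2) auto
  then have "a \<le> (1 / (2 * pi) * integral {0..2*pi} (\<lambda>t. ?g t powr p)) powr (1 / p)"
    using a p by (simp add: powr_powr)
  then show ?thesis
    using r by (simp add: Mp_def a_def deriv_F norm_mult)
qed

end

section \<open>Integrals and sums over shells\<close>

text \<open>The exponent may have either sign (it will be \<open>e - 2\<close>), so the extreme
  power can sit at either end of the range. The sum and the minimum of the two endpoint constants
  cover both cases at once.\<close>

lemma powr_scaled_bounds:
  fixes x d s S e :: real
  assumes "0 < s" "0 < d" "s * d \<le> x" "x \<le> S * d"
  shows "x powr e \<le> (s powr e + S powr e) * d powr e"
    and "min (s powr e) (S powr e) * d powr e \<le> x powr e"
proof -
  have sd: "0 < s * d" using assms by simp
  then have S: "0 < S" using assms by (smt (verit) zero_less_mult_iff)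
  have x: "0 < x" using sd assms by linarith
  have split: "(s * d) powr e = s powr e * d powr e" "(S * d) powr e = S powr e * d powr e"
    using assms S by (auto simp: powr_mult)
  have nonneg: "0 \<le> s powr e * d powr e" "0 \<le> S powr e * d powr e" by simp_all
  have min: "min (s powr e) (S powr e) * d powr e \<le> s powr e * d powr e"
    "min (s powr e) (S powr e) * d powr e \<le> S powr e * d powr e"
    by (intro mult_right_mono; simp)+
  show "x powr e \<le> (s powr e + S powr e) * d powr e"
  proof (cases "0 \<le> e")
    case True
    then have "x powr e \<le> S powr e * d powr e"
      using assms sd x unfolding split(2)[symmetric] by (intro powr_mono2) auto
    then show ?thesis using nonneg unfolding distrib_right by linarith
  next
    case False
    then have "x powr e \<le> s powr e * d powr e"
      using assms sd x unfolding split(1)[symmetric] by (intro powr_mono2') auto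
    then show ?thesis using nonneg unfolding distrib_right by linarith
  qed
  show "min (s powr e) (S powr e) * d powr e \<le> x powr e"
  proof (cases "0 \<le> e")
    case True
    then have "s powr e * d powr e \<le> x powr e"
      using assms sd x unfolding split(1)[symmetric] by (intro powr_mono2) auto
    then show ?thesis using min(1) by linarith
  next
    case False
    then have "S powr e * d powr e \<le> x powr e"
      using assms sd x unfolding split(2)[symmetric] by (intro powr_mono2') auto
    then show ?thesis using min(2) by linarith
  qed
qed

text \<open>Compare with the step function of height \<open>c n\<close> on \<open>I n\<close>,
  integrated term by term.\<close>

lemma nn_integral_finite_if_shells_summable:
  assumes sets: "\<And>n. I n \<in> sets M" and cover: "\<Omega> \<subseteq> (\<Union>n. I n)"
    and m: "\<And>n. emeasure M (I n) \<le> ennreal (m n)" "\<And>n. 0 \<le> m n"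
    and G: "\<And>n x. x \<in> I n \<Longrightarrow> x \<in> \<Omega> \<Longrightarrow> G x \<le> c n" and c: "\<And>n. 0 \<le> c n"
    and summ: "summable (\<lambda>n. c n * m n)"
  shows "(\<integral>\<^sup>+x\<in>\<Omega>. ennreal (G x) \<partial>M) < \<infinity>"
proof -
  have "(\<integral>\<^sup>+x\<in>\<Omega>. ennreal (G x) \<partial>M) \<le> (\<integral>\<^sup>+x. (\<Sum>n. ennreal (c n) * indicator (I n) x) \<partial>M)"
  proof (rule nn_integral_mono)
    fix x
    show "ennreal (G x) * indicator \<Omega> x \<le> (\<Sum>n. ennreal (c n) * indicator (I n) x)"
    proof (cases "x \<in> \<Omega>")
      case True
      then obtain n where n: "x \<in> I n" using cover by blast
      then have "ennreal (G x) * indicator \<Omega> x \<le> ennreal (c n) * indicator (I n) x"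
        using G[OF n True] True by (simp add: ennreal_leI)
      also have "\<dots> \<le> (\<Sum>n. ennreal (c n) * indicator (I n) x)"
        using sum_le_suminf[of "\<lambda>n. ennreal (c n) * indicator (I n) x" "{n}"] n by (simp del: sum_mult_indicator)
      finally show ?thesis .
    qed simp
  qed
  also have "\<dots> = (\<Sum>n. ennreal (c n) * emeasure M (I n))"
    using sets by (subst nn_integral_suminf) (auto simp: nn_integral_cmult_indicator)
  also have "\<dots> \<le> (\<Sum>n. ennreal (c n * m n))"
    using m c by (intro suminf_le) (auto simp: ennreal_mult intro!: mult_left_mono)
  also have "\<dots> = ennreal (\<Sum>n. c n * m n)"
    using m c summ by (intro suminf_ennreal2) auto
  finally show ?thesis by (simp add: order_le_less_trans)
qed

text \<open>The converse comparison: disjointness makes the step function equal to the single value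
  \<open>c n\<close> on \<open>I n\<close>, hence a minorant of \<open>G\<close>.\<close>

lemma shells_summable_if_nn_integral_finite:
  assumes sets: "\<And>n. I n \<in> sets M" and disj: "disjoint_family I" and sub: "\<And>n. I n \<subseteq> \<Omega>"
    and m: "\<And>n. ennreal (m n) \<le> emeasure M (I n)" "\<And>n. 0 \<le> m n"
    and G: "\<And>n x. x \<in> I n \<Longrightarrow> c n \<le> G x" and c: "\<And>n. 0 \<le> c n"
    and fin: "(\<integral>\<^sup>+x\<in>\<Omega>. ennreal (G x) \<partial>M) < \<infinity>"
  shows "summable (\<lambda>n. c n * m n)"
proof -
  have "(\<Sum>n. ennreal (c n * m n)) \<le> (\<Sum>n. ennreal (c n) * emeasure M (I n))"
    using m c by (intro suminf_le) (auto simp: ennreal_mult intro!: mult_left_mono)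
  also have "\<dots> = (\<integral>\<^sup>+x. (\<Sum>n. ennreal (c n) * indicator (I n) x) \<partial>M)"
    using sets by (subst nn_integral_suminf) (auto simp: nn_integral_cmult_indicator)
  also have "\<dots> \<le> (\<integral>\<^sup>+x\<in>\<Omega>. ennreal (G x) \<partial>M)"
  proof (rule nn_integral_mono)
    fix x
    show "(\<Sum>n. ennreal (c n) * indicator (I n) x) \<le> ennreal (G x) * indicator \<Omega> x"
    proof (cases "\<exists>n. x \<in> I n")
      case True
      then obtain n where n: "x \<in> I n" by blast
      then have "(\<Sum>n. ennreal (c n) * indicator (I n) x) = ennreal (c n)"
        by (intro suminf_cmult_indicator disj) auto
      then show ?thesis using n sub G by (auto simp: indicator_def intro: ennreal_leI)
    qed simp
  qed
  finally have "(\<Sum>n. ennreal (c n * m n)) \<noteq> top" using fin by (auto simp: top_unique)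
  then show ?thesis using m c by (intro summable_suminf_not_top) auto
qed

text \<open>With \<open>\<rho>\<close> comparable to \<open>d n\<close> on the \<open>n\<close>-th
  shell, the weight contributes \<open>d n powr (e - 2)\<close> and the measure one more factor
  \<open>d n\<close>. The abstract space lets one statement serve both radial integrals and area
  integrals over the disc.\<close>

lemma weighted_nn_integral_finite:
  fixes \<rho> H :: "'a \<Rightarrow> real" and d a :: "nat \<Rightarrow> real"
  assumes sets: "\<And>n. I n \<in> sets M" and cover: "\<Omega> \<subseteq> (\<Union>n. I n)"
    and meas: "\<And>n. emeasure M (I n) \<le> ennreal (K * d n)"
    and const: "0 < s" "0 \<le> K" "0 \<le> k" "0 \<le> e"
    and \<rho>: "\<And>n x. x \<in> I n \<Longrightarrow> x \<in> \<Omega> \<Longrightarrow> s * d n \<le> \<rho> x" "\<And>n x. x \<in> I n \<Longrightarrow> x \<in> \<Omega> \<Longrightarrow> \<rho> x \<le> S * d n"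
    and H: "\<And>x. x \<in> \<Omega> \<Longrightarrow> 0 \<le> H x" "\<And>n x. x \<in> I n \<Longrightarrow> x \<in> \<Omega> \<Longrightarrow> H x \<le> a n"
    and d: "\<And>n. 0 < d n"
    and summ: "summable (\<lambda>n. d n powr (e - 1) * a n powr e)"
  shows "(\<integral>\<^sup>+x\<in>\<Omega>. ennreal (k * \<rho> x powr (e - 2) * H x powr e) \<partial>M) < \<infinity>"
proof (rule nn_integral_finite_if_shells_summable[OF sets cover meas])
  let ?C = "s powr (e - 2) + S powr (e - 2)"
  let ?c = "\<lambda>n. k * (?C * d n powr (e - 2)) * a n powr e"
  show "k * \<rho> x powr (e - 2) * H x powr e \<le> ?c n" if "x \<in> I n" "x \<in> \<Omega>" for n x
    using const powr_scaled_bounds(1)[OF _ d \<rho>(1)[OF that] \<rho>(2)[OF that], of "e - 2"]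
      powr_mono2[OF _ H(1)[OF that(2)] H(2)[OF that], of e]
    by (intro mult_mono mult_nonneg_nonneg add_nonneg_nonneg powr_ge_zero order_refl) auto
  have "?c n * (K * d n) = (k * ?C * K) * (d n powr (e - 1) * a n powr e)" for n
  proof -
    have "d n powr (e - 1) = d n powr (e - 2) * d n"
      using d[of n] powr_add[of "d n" "e - 2" 1] by simp
    then show ?thesis by (simp add: mult_ac)
  qed
  then show "summable (\<lambda>n. ?c n * (K * d n))"
    using summable_mult[OF summ] by presburger
qed (use const d in \<open>auto intro!: mult_nonneg_nonneg add_nonneg_nonneg less_imp_le[OF d]\<close>)

text \<open>The lower-bound counterpart. It discretises the finite \<open>p\<close>-integral of
  \<open>\<phi>\<close> and, by contradiction, proves divergence of the
  \<open>q\<close>-integrals.\<close>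

lemma weighted_nn_integral_finiteD:
  fixes \<rho> H :: "'a \<Rightarrow> real" and d a :: "nat \<Rightarrow> real"
  assumes sets: "\<And>n. I n \<in> sets M" and disj: "disjoint_family I" and sub: "\<And>n. I n \<subseteq> \<Omega>"
    and meas: "\<And>n. ennreal (K * d n) \<le> emeasure M (I n)"
    and const: "0 < s" "0 < S" "0 < K" "0 < k" "0 \<le> e"
    and \<rho>: "\<And>n x. x \<in> I n \<Longrightarrow> s * d n \<le> \<rho> x" "\<And>n x. x \<in> I n \<Longrightarrow> \<rho> x \<le> S * d n"
    and a: "\<And>n. 0 \<le> a n" and H: "\<And>n x. x \<in> I n \<Longrightarrow> a n \<le> H x"
    and d: "\<And>n. 0 < d n"
    and fin: "(\<integral>\<^sup>+x\<in>\<Omega>. ennreal (k * \<rho> x powr (e - 2) * H x powr e) \<partial>M) < \<infinity>"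
  shows "summable (\<lambda>n. d n powr (e - 1) * a n powr e)"
proof -
  define C where "C = min (s powr (e - 2)) (S powr (e - 2))"
  have C: "0 < C" using const by (simp add: C_def)
  let ?c = "\<lambda>n. k * (C * d n powr (e - 2)) * a n powr e"
  have "summable (\<lambda>n. ?c n * (K * d n))"
  proof (rule shells_summable_if_nn_integral_finite[OF sets disj sub meas])
    show "?c n \<le> k * \<rho> x powr (e - 2) * H x powr e" if "x \<in> I n" for n x
      using const C powr_scaled_bounds(2)[OF _ d \<rho>(1)[OF that] \<rho>(2)[OF that], of "e - 2", folded C_def]
        powr_mono2[OF _ a H[OF that], of e]
      by (intro mult_mono mult_nonneg_nonneg powr_ge_zero order_refl) auto
  qed (use const C fin in \<open>auto intro!: mult_nonneg_nonneg less_imp_le[OF d]\<close>)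
  moreover have "?c n * (K * d n) = (k * C * K) * (d n powr (e - 1) * a n powr e)" for n
  proof -
    have "d n powr (e - 1) = d n powr (e - 2) * d n"
      using d[of n] powr_add[of "d n" "e - 2" 1] by simp
    then show ?thesis by (simp add: mult_ac)
  qed
  ultimately show ?thesis using const C by (auto simp: summable_cmult_iff)
qed

section \<open>Intervals, annuli and geometric shells\<close>

lemma disjoint_family_intervals:
  fixes u v :: "nat \<Rightarrow> real"
  assumes "\<And>n. u n \<le> v n" "\<And>n. v n \<le> u (Suc n)"
  shows "disjoint_family (\<lambda>n. {u n..<v n})"
proof -
  have "incseq u" using assms order_trans by (intro incseq_SucI) blast
  then have "v m \<le> u n" if "m < n" for m n
    using assms(2)[of m] that incseqD[of u "Suc m" n] by linarith
  then show ?thesis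
    unfolding disjoint_family_on_def by (metis disjoint_iff atLeastLessThan_iff linorder_neqE_nat not_less order_trans)
qed

lemma emeasure_annulus:
  assumes "0 \<le> a" "a \<le> b"
  shows "emeasure lborel {z::complex. norm z \<in> {a..<b}} = ennreal (pi * (b\<^sup>2 - a\<^sup>2))"
proof -
  have "{z::complex. norm z \<in> {a..<b}} = ball 0 b - ball 0 a" by auto
  also have "emeasure lborel \<dots> = emeasure lborel (ball (0::complex) b) - emeasure lborel (ball (0::complex) a)"
    using assms by (intro emeasure_Diff) (auto simp: emeasure_ball)
  also have "\<dots> = ennreal (pi * b\<^sup>2) - ennreal (pi * a\<^sup>2)"
    using assms by (simp add: emeasure_ball unit_ball_vol_2)
  also have "\<dots> = ennreal (pi * (b\<^sup>2 - a\<^sup>2))"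
    using assms by (subst ennreal_minus) (auto simp: right_diff_distrib)
  finally show ?thesis .
qed

lemma annulus_sets: "{z::complex. norm z \<in> {a..<b}} \<in> sets lborel"
proof -
  have "{z::complex. norm z \<in> {a..<b}} = ball 0 b - ball 0 a" by auto
  then show ?thesis by simp
qed

lemma geometric_shell_exists:
  fixes r :: real and L :: nat
  assumes "0 \<le> r" "r < 1" "2 \<le> L"
  obtains n where "1 - 1 / real L ^ n \<le> r" "r < 1 - 1 / real L ^ Suc n"
proof -
  let ?P = "\<lambda>n. r < 1 - 1 / real L ^ n"
  obtain N where "(1 / real L) ^ N < 1 - r"
    using real_arch_pow_inv[of "1 - r" "1 / real L"] assms by auto
  then have P: "?P N" by (simp add: power_one_over)
  have "\<not> ?P 0" using assms by simp
  \<comment> \<open>The least index is positive since \<open>r \<ge> 0\<close>; its predecessor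
    labels the shell containing \<open>r\<close>.\<close>
  then obtain n where "(LEAST n. ?P n) = Suc n"
    using LeastI[of ?P, OF P] by (metis not0_implies_Suc)
  then show thesis
    using LeastI[of ?P, OF P] not_less_Least[of n ?P] by (intro that[of n]) auto
qed

section \<open>Choice of the coefficients\<close>

text \<open>The regularisation is applied to
  \<open>x n = d n powr (p - 1) * \<psi> n powr p\<close>. In these terms
  \<open>\<psi> (Suc n) \<ge> 9 * \<psi> n\<close> becomes a ratio of at least
  \<open>9 powr p / L powr (p - 1)\<close>, which is below 1 by hypothesis, and
  \<open>\<psi> (Suc n) \<le> L * \<psi> n\<close> a ratio of at most \<open>L\<close>.\<close>

lemma regular_gap_series_majorant:
  fixes \<phi> :: "nat \<Rightarrow> real"
  assumes p: "1 < p" and L: "257 \<le> L" "9 powr p < real L powr (p - 1)"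
    and \<phi>: "\<And>n. 0 < \<phi> n"
    and summ: "summable (\<lambda>n. (1 / real L ^ n) powr (p - 1) * \<phi> n powr p)"
  obtains \<psi> where "regular_gap_series L \<psi>" "\<And>n. \<phi> n \<le> \<psi> n"
    "summable (\<lambda>n. (1 / real L ^ n) powr (p - 1) * \<psi> n powr p)"
proof -
  define d where "d n = 1 / real L ^ n" for n
  have L0: "0 < real L" using L by simp
  have d: "0 < d n" for n using L0 by (simp add: d_def)
  have dS: "d (Suc n) powr (p - 1) = d n powr (p - 1) / real L powr (p - 1)" for n
    using L0 by (simp add: d_def powr_divide powr_mult)
  let ?y = "\<lambda>n. d n powr (p - 1) * \<phi> n powr p"
  let ?b = "9 powr p / real L powr (p - 1)" and ?c = "1 / real L"
  have b: "0 < ?b" "?b < 1" using L L0 by (simp_all add: divide_less_eq)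
  have c: "0 < ?c" "?c < 1" using L by simp_all
  have y: "0 < ?y n" for n using d[of n] \<phi>[of n] by simp
  have "0 \<le> ?y n" for n using y[of n] by (rule less_imp_le)
  then obtain x where x: "\<And>n. ?y n \<le> x n" "summable x" "\<And>n. ?b * x n \<le> x (Suc n)" "\<And>n. ?c * x (Suc n) \<le> x n"
    using doubly_regularized_majorant[of ?y ?b ?c] summ b c unfolding d_def by blast
  have x0: "0 < x n" for n using x(1)[of n] y[of n] by linarith
  define A where "A n = x n / d n powr (p - 1)" for n
  define \<psi> where "\<psi> n = A n powr (1 / p)" for n
  have A0: "0 < A n" for n using x0 d[of n] by (simp add: A_def)
  have root: "(B powr p * A n) powr (1 / p) = B * \<psi> n" if "0 < B" for B n
    using that A0[of n] p by (simp add: powr_mult powr_powr \<psi>_def)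
  have AS: "A (Suc n) = real L powr (p - 1) * x (Suc n) / d n powr (p - 1)" for n
    unfolding A_def dS by simp
  have \<psi>p: "d n powr (p - 1) * \<psi> n powr p = x n" for n
    using A0[of n] d[of n] p by (simp add: \<psi>_def powr_powr) (simp add: A_def)
  have "\<phi> n \<le> \<psi> n" for n
  proof -
    have "\<phi> n powr p \<le> A n"
      using x(1)[of n] d[of n] by (simp add: A_def field_simps)
    then have "(\<phi> n powr p) powr (1 / p) \<le> \<psi> n"
      unfolding \<psi>_def using p by (intro powr_mono2) auto
    then show ?thesis using \<phi>[of n] p by (simp add: powr_powr)
  qed
  moreover have "regular_gap_series L \<psi>"
  proof
    show "0 < \<psi> n" for n using A0[of n] by (simp add: \<psi>_def)
    show "9 * \<psi> n \<le> \<psi> (Suc n)" for n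
    proof -
      have "9 powr p * x n \<le> real L powr (p - 1) * x (Suc n)"
        using x(3)[of n] L0 by (simp add: field_simps)
      then have "9 powr p * A n \<le> A (Suc n)"
        unfolding AS using d[of n] by (simp add: A_def divide_right_mono)
      then have "(9 powr p * A n) powr (1 / p) \<le> \<psi> (Suc n)"
        unfolding \<psi>_def using p A0[of n] by (intro powr_mono2) auto
      then show ?thesis by (simp add: root)
    qed
    show "\<psi> (Suc n) \<le> real L * \<psi> n" for n
    proof -
      have "x (Suc n) \<le> real L * x n" using x(4)[of n] L0 by (simp add: field_simps)
      then have "real L powr (p - 1) * x (Suc n) \<le> real L powr (p - 1) * (real L * x n)"
        by (intro mult_left_mono) auto
      also have "\<dots> = real L powr p * x n" using L0 by (simp add: powr_diff)
      finally have "A (Suc n) \<le> real L powr p * A n"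
        unfolding AS using d[of n] by (simp add: A_def divide_right_mono)
      then have "\<psi> (Suc n) \<le> (real L powr p * A n) powr (1 / p)"
        unfolding \<psi>_def using p A0[of "Suc n"] by (intro powr_mono2) auto
      then show ?thesis using L0 by (simp add: root)
    qed
    \<comment> \<open>Since \<open>d n * \<psi> n\<close> is the \<open>p\<close>-th root of
      \<open>d n * x n\<close> and \<open>x\<close> is bounded by its sum, the terms decay like
      \<open>L powr (- n / p)\<close>.\<close>
    show "summable (\<lambda>n. \<psi> n / real L ^ n)"
    proof (rule summable_comparison_test')
      let ?q = "(1 / real L) powr (1 / p)"
      have "?q < 1 powr (1 / p)" using p L by (intro powr_less_mono2) auto
      then show "summable (\<lambda>n. suminf x powr (1 / p) * ?q ^ n)"
        by (intro summable_mult summable_geometric) auto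
      fix n
      have dq: "d n powr (1 / p) = ?q ^ n"
      proof -
        have "d n = (1 / real L) powr real n"
          using L0 by (simp add: d_def powr_realpow power_one_over)
        then show ?thesis using L0 by (simp add: powr_powr powr_power)
      qed
      have "x n \<le> suminf x"
        using sum_le_suminf[OF x(2), of "{n}"] less_imp_le[OF x0] by simp
      then have "d n * x n \<le> d n * suminf x" using d[of n] by simp
      moreover have "d n powr p * A n = d n * x n"
        using d[of n] by (simp add: A_def powr_diff)
      ultimately have "(d n powr p * A n) powr (1 / p) \<le> (d n * suminf x) powr (1 / p)"
        using p d[of n] x0[of n] by (intro powr_mono2) (auto intro: less_imp_le)
      then have "d n * \<psi> n \<le> (d n * suminf x) powr (1 / p)"
        using d by (simp add: root)
      also have "\<dots> = suminf x powr (1 / p) * ?q ^ n"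
        using d[of n] less_imp_le[OF x0] x(2) by (simp add: powr_mult dq[symmetric] suminf_nonneg)
      finally show "norm (\<psi> n / real L ^ n) \<le> suminf x powr (1 / p) * ?q ^ n"
        by (simp add: d_def \<psi>_def)
    qed
  qed (use L in auto)
  moreover have "summable (\<lambda>n. (1 / real L ^ n) powr (p - 1) * \<psi> n powr p)"
    using x(2) \<psi>p unfolding d_def by simp
  ultimately show thesis using that by blast
qed

section \<open>Construction of the function and its properties\<close>

theorem theorem1:
  fixes p q :: real and \<phi> :: "real \<Rightarrow> real"
  assumes "1 < q" and "q < p"
    and "\<forall>r\<in>{0..<1}. \<phi> r > 0"
    and "mono_on {0..<1} \<phi>"
    and "(\<integral>\<^sup>+ r \<in> {0..<1}. ennreal ((1 - r) powr (p - 2) * \<phi> r powr p) \<partial>lborel) < \<infinity>"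
    and "(\<integral>\<^sup>+ r \<in> {0..<1}. ennreal ((1 - r) powr (q - 2) * \<phi> r powr q) \<partial>lborel) = \<infinity>"
  shows "\<exists>f. f \<in> (Besov p \<inter> Hinf) - Besov q
          \<and> (\<exists>C r0. C > 0 \<and> 0 < r0 \<and> r0 < 1 \<and> (\<forall>r\<in>{r0..<1}. Mp p r (deriv f) \<ge> C * \<phi> r))
          \<and> (\<forall>\<theta>\<in>{0..2*pi}. (\<integral>\<^sup>+ r \<in> {0..<1}. ennreal ((1 - r) powr (q - 2) * norm (deriv f (complex_of_real r * cis \<theta>)) powr q) \<partial>lborel) = \<infinity>)"
proof -
  have p: "1 < p" using assms by simp
  have mono: "\<phi> r \<le> \<phi> s" if "0 \<le> r" "r \<le> s" "s < 1" for r s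
    using assms(4) that by (auto simp: mono_on_def)
  \<comment> \<open>257 serves the lower bound on \<open>G\<close>; the other summand makes
    \<open>9 powr p < L powr (p - 1)\<close>, so that both growth conditions are compatible with
    summability.\<close>
  obtain L :: nat where "257 + 9 powr (p / (p - 1)) \<le> real L"
    using real_arch_simple by blast
  moreover have "0 < 9 powr (p / (p - 1))" by simp
  ultimately have L: "257 \<le> L" and "9 powr (p / (p - 1)) < real L" by linarith+
  then have "(9 powr (p / (p - 1))) powr (p - 1) < real L powr (p - 1)"
    using p by (intro powr_less_mono2) auto
  then have Lp: "9 powr p < real L powr (p - 1)" using p by (simp add: powr_powr)
  have L1: "257 \<le> real L" using L by simp
  define d where "d n = 1 / real L ^ n" for n
  have d: "0 < d n" "d n \<le> 1" for n using L1 by (simp_all add: d_def)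
  have dS: "d (Suc n) = d n / real L" for n by (simp add: d_def)
  have dS_le: "d (Suc n) \<le> d n / 257" for n
    unfolding dS using d[of n] L1 by (intro divide_left_mono) auto
  have \<phi>_pos: "0 < \<phi> (1 - d n)" for n
    using assms(3) d[of n] by auto
  \<comment> \<open>The \<open>I n\<close> tile the unit interval; \<open>J n\<close>, inside
    \<open>I n\<close>, is where the \<open>n\<close>-th term dominates.\<close>
  define I where "I n = {1 - d n..<1 - d (Suc n)}" for n
  define J where "J n = {1 - d n / 2..<1 - d n / 4}" for n
  have disj_I: "disjoint_family I"
    unfolding I_def
  proof (rule disjoint_family_intervals)
    show "1 - d n \<le> 1 - d (Suc n)" for n
      using d[of n] dS_le[of n] by linarith
  qed simp
  have disj_J: "disjoint_family J"
    unfolding J_def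
  proof (rule disjoint_family_intervals)
    show "1 - d n / 2 \<le> 1 - d n / 4" "1 - d n / 4 \<le> 1 - d (Suc n) / 2" for n
      using d[of n] dS_le[of n] by linarith+
  qed
  have I_bounds: "0 \<le> r" "r < 1" "1 / real L * d n \<le> 1 - r" "1 - r \<le> 1 * d n" if "r \<in> I n" for r n
    using that d[of n] d[of "Suc n"] dS[of n] by (auto simp: I_def)
  have J_bounds: "0 \<le> r" "r < 1" "1 / 4 * d n \<le> 1 - r" "1 - r \<le> 1 / 2 * d n" if "r \<in> J n" for r n
    using that d[of n] by (auto simp: J_def)
  have I_cover: "\<exists>n. r \<in> I n" if r: "0 \<le> r" "r < 1" for r
  proof -
    obtain n where "1 - 1 / real L ^ n \<le> r" "r < 1 - 1 / real L ^ Suc n"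
      using geometric_shell_exists[OF r, of L] L by auto
    then show ?thesis unfolding I_def d_def by auto
  qed
  have meas_I: "emeasure lborel (I n) = ennreal ((1 - 1 / real L) * d n)" for n
  proof -
    have "1 - d n \<le> 1 - d (Suc n)" using d[of n] dS_le[of n] by linarith
    then show ?thesis
      unfolding I_def by (subst emeasure_lborel_Ico) (auto simp: dS algebra_simps)
  qed
  have meas_J: "emeasure lborel (J n) = ennreal (1 / 4 * d n)" for n
    unfolding J_def using d[of n] by simp

  \<comment> \<open>By monotonicity, \<open>\<phi>\<close> on \<open>I n\<close> is at least its
    value at the left endpoint.\<close>
  have "summable (\<lambda>n. d n powr (p - 1) * \<phi> (1 - d n) powr p)"
  proof (rule weighted_nn_integral_finiteD[where I = I and M = lborel and \<Omega> = "{0..<1}"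
        and K = "1 - 1 / real L" and s = "1 / real L" and S = 1 and k = 1 and \<rho> = "\<lambda>r. 1 - r" and H = \<phi>, OF _ disj_I])
    show "\<phi> (1 - d n) \<le> \<phi> r" if "r \<in> I n" for n r
      using that I_bounds[OF that] d[of n] by (intro mono) (auto simp: I_def)
  qed (use L1 p assms(5) I_bounds less_imp_le[OF \<phi>_pos] d in \<open>auto simp: meas_I, auto simp: I_def\<close>)
  then obtain \<psi> where "regular_gap_series L \<psi>" and \<phi>\<psi>: "\<And>n. \<phi> (1 - d n) \<le> \<psi> n"
    and summ: "summable (\<lambda>n. d n powr (p - 1) * \<psi> n powr p)"
    using regular_gap_series_majorant[OF p L Lp, of "\<lambda>n. \<phi> (1 - d n)"] \<phi>_pos unfolding d_def by blast
  interpret regular_gap_series L \<psi> by fact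

  \<comment> \<open>Both divergence claims reduce to this sum. On \<open>I n\<close>,
    \<open>\<phi>\<close> is at most its value at the right endpoint, hence at most
    \<open>\<psi> (Suc n)\<close>, so convergence would make the \<open>q\<close>-integral of
    \<open>\<phi>\<close> finite. The index shift costs \<open>L powr (q - 1)\<close>, and
    \<open>4 powr q\<close> undoes the division by 4.\<close>
  have not_summ: False if *: "summable (\<lambda>n. d n powr (q - 1) * (\<psi> n / 4) powr q)"
  proof -
    have "summable (\<lambda>n. real L powr (q - 1) * (4 powr q * (d (Suc n) powr (q - 1) * (\<psi> (Suc n) / 4) powr q)))"
      by (intro summable_mult summable_Suc_iff[THEN iffD2, OF *])
    moreover have "real L powr (q - 1) * (4 powr q * (d (Suc n) powr (q - 1) * (\<psi> (Suc n) / 4) powr q))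
        = d n powr (q - 1) * \<psi> (Suc n) powr q" for n
      using pos[of "Suc n"] d[of n] L1 by (simp add: dS powr_divide)
    ultimately have "summable (\<lambda>n. d n powr (q - 1) * \<psi> (Suc n) powr q)" by (simp only:)
    then have "(\<integral>\<^sup>+ r \<in> {0..<1}. ennreal (1 * (1 - r) powr (q - 2) * \<phi> r powr q) \<partial>lborel) < \<infinity>"
    proof (rule weighted_nn_integral_finite[where I = I and K = "1 - 1 / real L" and s = "1 / real L" and S = 1, rotated -1])
      show "\<phi> r \<le> \<psi> (Suc n)" if "r \<in> I n" for n r
      proof -
        have "\<phi> r \<le> \<phi> (1 - d (Suc n))"
          using that I_bounds[OF that] d[of "Suc n"] by (intro mono) (auto simp: I_def)
        then show ?thesis using \<phi>\<psi>[of "Suc n"] by linarith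
      qed
      show "0 \<le> \<phi> r" if "r \<in> {0..<1}" for r using assms(3) that by (simp add: less_imp_le)
      show "{0..<1} \<subseteq> (\<Union>n. I n)" using I_cover by auto
    qed (use L1 assms(1) I_bounds d in \<open>auto simp: meas_I, auto simp: I_def\<close>)
    then show False using assms(6) by simp
  qed

  have G_lower: "\<psi> n / 4 \<le> norm (deriv F z)" if "norm z \<in> J n" for n z
    using J_bounds[OF that] norm_G_ge[of z n] by (simp add: deriv_F d_def)
  have G_upper: "norm (deriv F z) \<le> 4 * (real L)\<^sup>2 * \<psi> n" if "norm z \<in> I n" for n z
    using I_bounds[OF that] norm_G_le[of z n] by (simp add: deriv_F d_def)
  have weight: "1 - norm z \<le> 1 - (norm z)\<^sup>2" "1 - (norm z)\<^sup>2 \<le> 2 * (1 - norm z)" if "norm z < 1" for z :: complex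
  proof -
    have eq: "1 - (norm z)\<^sup>2 = (1 + norm z) * (1 - norm z)" by (simp add: power2_eq_square algebra_simps)
    have "1 * (1 - norm z) \<le> (1 + norm z) * (1 - norm z)"
      using that by (intro mult_right_mono) auto
    then show "1 - norm z \<le> 1 - (norm z)\<^sup>2" unfolding eq by simp
    show "1 - (norm z)\<^sup>2 \<le> 2 * (1 - norm z)"
      unfolding eq using that by (intro mult_right_mono) auto
  qed
  have F_hol: "F holomorphic_on ball 0 1" using F_Hinf by (simp add: Hinf_def)

  have "(\<integral>\<^sup>+ z \<in> ball 0 1. ennreal ((1 / pi) * (1 - (norm z)\<^sup>2) powr (p - 2) * norm (deriv F z) powr p) \<partial>lborel) < \<infinity>"
  proof (rule weighted_nn_integral_finite[where I = "\<lambda>n. {z. norm z \<in> I n}" and K = "2 * pi" and s = "1 / real L" and S = 2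
        and a = "\<lambda>n. 4 * (real L)\<^sup>2 * \<psi> n" and d = d])
    show "{z::complex. norm z \<in> I n} \<in> sets lborel" for n
      unfolding I_def by (rule annulus_sets)
    show "ball 0 1 \<subseteq> (\<Union>n. {z::complex. norm z \<in> I n})" using I_cover by auto
    show "emeasure lborel {z::complex. norm z \<in> I n} \<le> ennreal (2 * pi * d n)" for n
    proof -
      define u v where "u = 1 - d n" and "v = 1 - d (Suc n)"
      have uv: "0 \<le> u" "u \<le> v" "v \<le> 1" "v - u \<le> d n"
        using d[of n] d[of "Suc n"] dS_le[of n] by (auto simp: u_def v_def)
      have "v\<^sup>2 - u\<^sup>2 = (v + u) * (v - u)" by (simp add: power2_eq_square algebra_simps)
      also have "\<dots> \<le> 2 * d n" using uv d[of n] by (intro mult_mono) auto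
      finally have "pi * (v\<^sup>2 - u\<^sup>2) \<le> pi * (2 * d n)" by (intro mult_left_mono) auto
      then show ?thesis
        unfolding I_def u_def[symmetric] v_def[symmetric] emeasure_annulus[OF uv(1,2)]
        by (intro ennreal_leI) (simp add: mult_ac)
    qed
    show "1 / real L * d n \<le> 1 - (norm z)\<^sup>2" if "z \<in> {z. norm z \<in> I n}" for n and z :: complex
      using that I_bounds[of "norm z" n] weight(1)[of z] by simp
    show "1 - (norm z)\<^sup>2 \<le> 2 * d n" if "z \<in> {z. norm z \<in> I n}" for n and z :: complex
      using that I_bounds[of "norm z" n] weight(2)[of z] by simp
    have "d n powr (p - 1) * (4 * (real L)\<^sup>2 * \<psi> n) powr p
        = (4 * (real L)\<^sup>2) powr p * (d n powr (p - 1) * \<psi> n powr p)" for n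
      using pos[of n] by (simp add: powr_mult)
    then show "summable (\<lambda>n. d n powr (p - 1) * (4 * (real L)\<^sup>2 * \<psi> n) powr p)"
      by (simp only: summable_mult[OF summ])
  qed (use L1 p G_upper d in auto)
  then have "F \<in> Besov p" using F_hol by (simp add: Besov_def)

  moreover have "F \<notin> Besov q"
  proof
    assume "F \<in> Besov q"
    then have fin: "(\<integral>\<^sup>+ z \<in> ball 0 1. ennreal ((1 / pi) * (1 - (norm z)\<^sup>2) powr (q - 2) * norm (deriv F z) powr q) \<partial>lborel) < \<infinity>"
      by (simp add: Besov_def)
    have "summable (\<lambda>n. d n powr (q - 1) * (\<psi> n / 4) powr q)"
    proof (rule weighted_nn_integral_finiteD[where I = "\<lambda>n. {z. norm z \<in> J n}" and K = "pi / 4" and s = "1 / 4" and S = 1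
          and a = "\<lambda>n. \<psi> n / 4" and d = d, OF _ _ _ _ _ _ _ _ _ _ _ _ _ _ fin])
      show "{z::complex. norm z \<in> J n} \<in> sets lborel" for n
        unfolding J_def by (rule annulus_sets)
      show "disjoint_family (\<lambda>n. {z::complex. norm z \<in> J n})"
        using disj_J by (auto simp: disjoint_family_on_def)
      show "{z::complex. norm z \<in> J n} \<subseteq> ball 0 1" for n using J_bounds by auto
      show "ennreal (pi / 4 * d n) \<le> emeasure lborel {z::complex. norm z \<in> J n}" for n
      proof -
        define u v where "u = 1 - d n / 2" and "v = 1 - d n / 4"
        have uv: "0 \<le> u" "u \<le> v" "1 / 2 \<le> u" "1 / 2 \<le> v" "v - u = d n / 4"
          using d[of n] by (auto simp: u_def v_def)
        \<comment> \<open>Both radii are at least 1/2, so the area of the annulus is at least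
          \<open>pi\<close> times its width.\<close>
        have "1 * (v - u) \<le> (v + u) * (v - u)" using uv by (intro mult_right_mono) auto
        also have "\<dots> = v\<^sup>2 - u\<^sup>2" by (simp add: power2_eq_square algebra_simps)
        finally have "pi * (d n / 4) \<le> pi * (v\<^sup>2 - u\<^sup>2)" using uv by (intro mult_left_mono) auto
        then show ?thesis
          unfolding J_def u_def[symmetric] v_def[symmetric] emeasure_annulus[OF uv(1,2)]
          by (intro ennreal_leI) (simp add: mult_ac)
      qed
      show "1 / 4 * d n \<le> 1 - (norm z)\<^sup>2" if "z \<in> {z. norm z \<in> J n}" for n and z :: complex
        using that J_bounds[of "norm z" n] weight(1)[of z] by simp
      show "1 - (norm z)\<^sup>2 \<le> 1 * d n" if "z \<in> {z. norm z \<in> J n}" for n and z :: complex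
        using that J_bounds[of "norm z" n] weight(2)[of z] by simp
    qed (use assms(1) G_lower d less_imp_le[OF pos] in auto)
    then show False by (rule not_summ)
  qed

  \<comment> \<open>\<open>G_lower\<close> depends on the modulus only, so it holds along every
    radius.\<close>
  moreover have "(\<integral>\<^sup>+ r \<in> {0..<1}. ennreal ((1 - r) powr (q - 2) * norm (deriv F (complex_of_real r * cis \<theta>)) powr q) \<partial>lborel) = \<infinity>" for \<theta>
  proof (rule ccontr)
    assume "\<not> ?thesis"
    then have fin: "(\<integral>\<^sup>+ r \<in> {0..<1}. ennreal (1 * (1 - r) powr (q - 2) * norm (deriv F (complex_of_real r * cis \<theta>)) powr q) \<partial>lborel) < \<infinity>"
      by (simp add: less_top)
    have "summable (\<lambda>n. d n powr (q - 1) * (\<psi> n / 4) powr q)"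
    proof (rule weighted_nn_integral_finiteD[where I = J and K = "1 / 4" and s = "1 / 4" and S = "1 / 2"
          and a = "\<lambda>n. \<psi> n / 4" and d = d, OF _ disj_J _ _ _ _ _ _ _ _ _ _ _ _ fin])
      show "\<psi> n / 4 \<le> norm (deriv F (complex_of_real r * cis \<theta>))" if "r \<in> J n" for n r
        using that J_bounds[OF that] by (intro G_lower) (simp add: norm_mult)
    qed (use assms(1) J_bounds d less_imp_le[OF pos] in \<open>auto simp: meas_J, auto simp: J_def\<close>)
    then show False by (rule not_summ)
  qed

  \<comment> \<open>For \<open>r\<close> in \<open>I m\<close> the coefficient of index
    \<open>n = m - 1\<close> is used: there \<open>L ^ n * (1 - r) \<le> 1 / L\<close>, so the power
    of \<open>r\<close> stays above 1/2, whereas at index \<open>m\<close> Bernoulli's bound could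
    drop to 0. Passing from \<open>\<psi> (n + 2)\<close>, which dominates \<open>\<phi> r\<close>,
    down to \<open>\<psi> n\<close> costs \<open>L^2\<close>.\<close>
  moreover have "1 / (2 * (real L)\<^sup>2) * \<phi> r \<le> Mp p r (deriv F)" if r: "r \<in> {1 - 1 / real L..<1}" for r
  proof -
    have r01: "0 < r" "r < 1" using r L1 by (auto simp: less_le_trans[of 0 "1 - 1 / real L"])
    obtain m where m: "r \<in> I m" using I_cover[of r] r01 by auto
    \<comment> \<open>The starting radius \<open>1 - 1 / L\<close> is the right endpoint of
      \<open>I 0\<close>, so index \<open>m - 1\<close> exists.\<close>
    have "m \<noteq> 0"
    proof
      assume "m = 0"
      then show False using m r by (simp add: I_def d_def)
    qed
    then obtain n where n: "m = Suc n" using not0_implies_Suc by blast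
    have "\<phi> r \<le> \<phi> (1 - d (Suc m))"
      using m r01 d[of "Suc m"] by (intro mono) (auto simp: I_def)
    also have "\<dots> \<le> \<psi> (n + 2)" using \<phi>\<psi>[of "Suc m"] n by simp
    also have "\<dots> \<le> (real L)\<^sup>2 * \<psi> n" by (rule growth_iterated)
    also have "\<dots> \<le> (real L)\<^sup>2 * (2 * Mp p r (deriv F))"
    proof (intro mult_left_mono)
      have "1 / 2 \<le> 1 + real (L ^ n) * (r - 1)"
      proof -
        have "real (L ^ n) * (1 - r) \<le> real (L ^ n) * d (Suc n)"
          using m n by (intro mult_left_mono) (auto simp: I_def)
        also have "\<dots> = 1 / real L" using L1 by (simp add: d_def)
        also have "\<dots> \<le> 1 / 2" using L1 by (intro divide_left_mono) auto
        finally show ?thesis by (simp add: algebra_simps)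
      qed
      also have "\<dots> \<le> (1 + (r - 1)) ^ (L ^ n)" using r01 by (intro Bernoulli_inequality) auto
      finally have "1 / 2 \<le> r ^ (L ^ n)" by simp
      then have "\<psi> n * (1 / 2) \<le> \<psi> n * r ^ (L ^ n)" using pos[of n] by (intro mult_left_mono) auto
      also have "\<dots> \<le> Mp p r (deriv F)" using r01 p by (intro Mp_deriv_F_ge) auto
      finally show "\<psi> n \<le> 2 * Mp p r (deriv F)" by simp
    qed simp
    finally show ?thesis using L1 by (simp add: field_simps)
  qed
  moreover have "0 < 1 / (2 * (real L)\<^sup>2)" "0 < 1 - 1 / real L" "1 - 1 / real L < 1"
    using L1 by auto
  ultimately show ?thesis using F_Hinf by blast
qed

end
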